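(* Let $n\geq 6$ be a positive integer. Then for $k\geq 1$ fixed, $c(n,k)$ is of order $\Omega\big(n^{1/k}\big)$ as $n$ increases. That is, for every fixed integer $k\ge 1$ there exist a constant $C_k>0$ and an integer $n_k$ such that $c(n,k)\geq C_k\, n^{1/k}$ for all integers $n\geq \max(n_k,6,k)$.
   Context: All graphs are simple. $C_n$ denotes the cycle on $n$ vertices. A chord of $C_n$ is an edge joining two non-consecutive vertices of $C_n$. When a set $P$ of chords is added to $C_n$, a cycle in the resulting graph $C_n+P$ is a $k$-chord cycle if exactly $k$ of its edges belong to $P$ (its other edges being edges of $C_n$). For integers $n\geq 6$ and $1\leq k\leq n$, $c(n,k)$ is the smallest number of chords which must be added to $C_n$ so that the resulting graph has $k$-chord cycles of all possible lengths. Here "all possible lengths" means: for $k=1$, every length $l$ with $3\leq l\leq n-1$ (no Hamilton cycle can use exactly one chord of another Hamilton cycle); for $k\geq 2$, every length $l$ with $\max(3,k)\leq l\leq n$. $c(n,k)$ is undefined for $k>n$. *)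

theory Defs
  imports Complex_Main
begin

definition closed_walk_edges :: "'a list \<Rightarrow> 'a set set" where
  "closed_walk_edges xs = {{xs ! i, xs ! (Suc i mod length xs)} | i. i < length xs}"

text \<open>
  A cycle of a simple graph with edge set \<open>E\<close> is given by the list of its vertices in cyclic
  order. Since these vertices are distinct and there are at least three of them, the number of
  edges of the cycle is the length of the list.
\<close>

definition is_cycle :: "'a set set \<Rightarrow> 'a list \<Rightarrow> bool" where
  "is_cycle E xs \<longleftrightarrow> 3 \<le> length xs \<and> distinct xs \<and> closed_walk_edges xs \<subseteq> E"

text \<open>The cycle \<open>C\<^sub>n\<close> has the vertices \<open>0, \<dots>, n - 1\<close>.\<close>

definition cycle_graph :: "nat \<Rightarrow> nat set set" where
  "cycle_graph n = closed_walk_edges [0..<n]"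

definition chords :: "nat \<Rightarrow> nat set set" where
  "chords n = {{u, v} | u v. u < n \<and> v < n \<and> u \<noteq> v} - cycle_graph n"

definition k_chord_cycle :: "nat \<Rightarrow> nat set set \<Rightarrow> nat \<Rightarrow> nat list \<Rightarrow> bool" where
  "k_chord_cycle n P k xs \<longleftrightarrow>
     is_cycle (cycle_graph n \<union> P) xs \<and> card (closed_walk_edges xs \<inter> P) = k"

text \<open>
  A cycle with exactly one chord cannot be a Hamilton cycle, and a cycle with \<open>k\<close> chords has
  at least \<open>k\<close> edges.
\<close>

definition possible_lengths :: "nat \<Rightarrow> nat \<Rightarrow> nat set" where
  "possible_lengths n k = (if k = 1 then {3..n - 1} else {max 3 k..n})"

definition has_all_k_chord_cycles :: "nat \<Rightarrow> nat set set \<Rightarrow> nat \<Rightarrow> bool" where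
  "has_all_k_chord_cycles n P k \<longleftrightarrow>
     (\<forall>l\<in>possible_lengths n k. \<exists>xs. length xs = l \<and> k_chord_cycle n P k xs)"

text \<open>
  The number \<open>c(n, k)\<close>; it is only meaningful for \<open>n \<ge> 6\<close> and \<open>1 \<le> k \<le> n\<close>.
\<close>

definition min_chords :: "nat \<Rightarrow> nat \<Rightarrow> nat" where
  "min_chords n k = (LEAST m. \<exists>P. P \<subseteq> chords n \<and> card P = m \<and> has_all_k_chord_cycles n P k)"

end

theory Submission
  imports Defs
begin

text \<open>
  The bound is a counting argument. Let \<open>P\<close> be a set of \<open>m\<close> chords. A vertex of a cycle lies on
  exactly two of its edges, so at a vertex that meets none of the chords used, the cycle either
  contains both edges of \<open>C\<^sub>n\<close> or neither. Running around \<open>C\<^sub>n\<close>, the cycle can therefore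
  switch between using and not using the edges of \<open>C\<^sub>n\<close> only at an endpoint of one of its chords
  (\<open>edges_determined\<close>). A cycle with a given set of \<open>k\<close> chords is thus determined by which edges
  \<open>{v, v + 1}\<close> it contains, for \<open>v\<close> among the at most \<open>2k\<close> endpoints of these chords, which leaves
  at most \<open>4\<^sup>k\<close> cycles for each of the at most \<open>m\<^sup>k\<close> choices of the chords
  (\<open>card_possible_lengths_le\<close>). Cycles of different lengths are different, so having
  all lengths forces \<open>m\<^sup>k * 4\<^sup>k\<close> to be at least the number of lengths, which is at least \<open>n / 2\<close>
  for large \<open>n\<close>. Hence \<open>n \<le> (8 * m)\<^sup>k\<close>.

  The number \<open>c(n, k)\<close> is a least element, so it obeys this bound only if at least one
  admissible set of chords exists. For large \<open>n\<close> the set of all chords is admissible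
  (\<open>all_chords_suffice\<close>), by two explicit families of cycles.
\<close>

section \<open>Edges of a cycle\<close>

lemma inj_on_closed_walk_edge:
  assumes "distinct xs" "3 \<le> length xs"
  shows "inj_on (\<lambda>i. {xs ! i, xs ! (Suc i mod length xs)}) {..<length xs}"
proof (rule inj_onI)
  fix i j assume "i \<in> {..<length xs}" "j \<in> {..<length xs}"
    and eq: "{xs ! i, xs ! (Suc i mod length xs)} = {xs ! j, xs ! (Suc j mod length xs)}"
  then have ij: "i < length xs" "j < length xs" by auto
  have lt: "Suc i mod length xs < length xs" "Suc j mod length xs < length xs"
    using assms(2) by (auto intro!: mod_less_divisor)
  have "i = j \<or> (i = Suc j mod length xs \<and> j = Suc i mod length xs)"
    using eq ij lt assms(1) by (auto simp: doubleton_eq_iff nth_eq_iff_index_eq)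
  then show "i = j"
    using ij assms(2) by (auto simp: mod_Suc split: if_splits)
qed

lemma closed_walk_edges_eq_image:
  "closed_walk_edges xs = (\<lambda>i. {xs ! i, xs ! (Suc i mod length xs)}) ` {..<length xs}"
  by (auto simp: closed_walk_edges_def)

lemma finite_closed_walk_edges: "finite (closed_walk_edges xs)"
  by (simp add: closed_walk_edges_eq_image)

lemma card_closed_walk_edges:
  assumes "distinct xs" "3 \<le> length xs"
  shows "card (closed_walk_edges xs) = length xs"
  unfolding closed_walk_edges_eq_image
  using card_image[OF inj_on_closed_walk_edge[OF assms]] by simp

lemma in_closed_walk_edge_in_set:
  assumes "e \<in> closed_walk_edges xs" "x \<in> e"
  shows "x \<in> set xs"
proof -
  from assms obtain i where i: "i < length xs" "x = xs ! i \<or> x = xs ! (Suc i mod length xs)"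
    by (auto simp: closed_walk_edges_def)
  then have "Suc i mod length xs < length xs" by (intro mod_less_divisor) auto
  then show ?thesis using i by auto
qed

lemma card_edges_at_vertex:
  assumes "distinct xs" "3 \<le> length xs" "x \<in> set xs"
  shows "card {e \<in> closed_walk_edges xs. x \<in> e} = 2"
proof -
  let ?l = "length xs" and ?e = "\<lambda>i. {xs ! i, xs ! (Suc i mod length xs)}"
  obtain j where j: "j < ?l" "x = xs ! j" using assms(3) by (metis in_set_conv_nth)
  define p where "p = (if j = 0 then ?l - 1 else j - 1)"
  have p: "p < ?l" "p \<noteq> j" "Suc p mod ?l = j"
    using j assms(2) by (auto simp: p_def)
  have incident: "x \<in> ?e i \<longleftrightarrow> i = j \<or> i = p" if "i < ?l" for i
  proof -
    have lt: "Suc i mod ?l < ?l" using assms(2) by (intro mod_less_divisor) auto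
    have "x \<in> ?e i \<longleftrightarrow> i = j \<or> Suc i mod ?l = j"
      using that lt j assms(1) by (auto simp: nth_eq_iff_index_eq)
    also have "Suc i mod ?l = j \<longleftrightarrow> i = p"
      using that j(1) assms(2) by (auto simp: p_def mod_Suc split: if_splits)
    finally show ?thesis .
  qed
  have "{e \<in> closed_walk_edges xs. x \<in> e} = ?e ` {j, p}"
    unfolding closed_walk_edges_eq_image using incident j(1) p(1) by auto
  also have "card \<dots> = card {j, p}"
    by (rule card_image, rule inj_on_subset[OF inj_on_closed_walk_edge[OF assms(1,2)]])
      (use j(1) p(1) in auto)
  finally show ?thesis using p(2) by simp
qed

section \<open>The chords used and the edges at their endpoints determine the cycle\<close>

lemma cycle_graph_eq: "cycle_graph n = {{i, Suc i mod n} | i. i < n}"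
proof -
  have "[0..<n] ! i = i \<and> [0..<n] ! (Suc i mod n) = Suc i mod n" if "i < n" for i
  proof -
    have "Suc i mod n < n" using that by (intro mod_less_divisor) auto
    then show ?thesis using that by simp
  qed
  then show ?thesis by (force simp: cycle_graph_def closed_walk_edges_def)
qed

text \<open>
  At a vertex off the chords, the two edges of the cycle must be the two edges of \<open>C\<^sub>n\<close>.
\<close>

lemma both_cycle_graph_edges_or_none:
  assumes "3 \<le> n" "is_cycle (cycle_graph n \<union> P) xs" "i < n"
    and off_chords: "Suc i mod n \<notin> \<Union> (closed_walk_edges xs \<inter> P)"
  shows "{Suc i mod n, Suc (Suc i mod n) mod n} \<in> closed_walk_edges xs
    \<longleftrightarrow> {i, Suc i mod n} \<in> closed_walk_edges xs"
proof (cases "Suc i mod n \<in> set xs")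
  case False
  then show ?thesis by (meson in_closed_walk_edge_in_set insertI1 insertI2)
next
  case True
  let ?v = "Suc i mod n"
  let ?at = "\<lambda>ys. {e \<in> closed_walk_edges ys. ?v \<in> e}"
  have v: "?v < n" using assms(1) by simp
  have "?at xs \<subseteq> ?at [0..<n]"
    using assms(2) off_chords unfolding is_cycle_def cycle_graph_def by blast
  moreover have "card (?at xs) = card (?at [0..<n])"
    using card_edges_at_vertex[of xs ?v] card_edges_at_vertex[of "[0..<n]" ?v] assms(1,2) True v
    by (simp add: is_cycle_def)
  ultimately have "?at xs = ?at [0..<n]"
    by (intro card_subset_eq) (auto simp: finite_closed_walk_edges)
  moreover have "{i, ?v} \<in> closed_walk_edges [0..<n]" "{?v, Suc ?v mod n} \<in> closed_walk_edges [0..<n]"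
    using cycle_graph_eq[of n] assms(3) v by (auto simp: cycle_graph_def)
  ultimately show ?thesis by blast
qed

text \<open>
  At the endpoint of some chord in \<open>K\<close> the two cycles agree on the next edge of \<open>C\<^sub>n\<close>. The
  agreement propagates once around \<open>C\<^sub>n\<close>: at an endpoint of a chord it holds by hypothesis,
  and at any other vertex each cycle repeats its previous decision.
\<close>

lemma edges_determined:
  assumes n: "3 \<le> n" and P: "P \<subseteq> chords n"
    and cyc: "is_cycle (cycle_graph n \<union> P) xs" "is_cycle (cycle_graph n \<union> P) ys"
    and K: "closed_walk_edges xs \<inter> P = K" "closed_walk_edges ys \<inter> P = K" "K \<noteq> {}"
    and B: "{v \<in> \<Union>K. {v, Suc v mod n} \<in> closed_walk_edges xs}
      = {v \<in> \<Union>K. {v, Suc v mod n} \<in> closed_walk_edges ys}"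
  shows "closed_walk_edges xs = closed_walk_edges ys"
proof -
  let ?agree = "\<lambda>v. {v, Suc v mod n} \<in> closed_walk_edges xs
    \<longleftrightarrow> {v, Suc v mod n} \<in> closed_walk_edges ys"
  have at_chord: "?agree v" if "v \<in> \<Union>K" for v
    using B that by blast
  obtain e where e: "e \<in> K" "e \<in> chords n" using K P by blast
  then obtain v where "v \<in> e" "v < n" unfolding chords_def by blast
  with e(1) have v: "v \<in> \<Union>K" "v < n" by auto
  have along: "?agree ((v + j) mod n)" for j
  proof (induction j)
    case 0
    then show ?case using at_chord[OF v(1)] v(2) by simp
  next
    case (Suc j)
    let ?i = "(v + j) mod n"
    have i: "?i < n" using n by simp
    have next_v: "(v + Suc j) mod n = Suc ?i mod n" by (simp add: mod_Suc_eq)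
    show ?case
    proof (cases "Suc ?i mod n \<in> \<Union>K")
      case True
      then show ?thesis unfolding next_v by (rule at_chord)
    next
      case False
      then show ?thesis
        unfolding next_v
        using both_cycle_graph_edges_or_none[OF n cyc(1) i]
          both_cycle_graph_edges_or_none[OF n cyc(2) i] K Suc.IH by blast
    qed
  qed
  have everywhere: "?agree i" if "i < n" for i
  proof -
    have "(v + (n - v + i)) mod n = i" using v(2) that by simp
    then show ?thesis using along[of "n - v + i"] by simp
  qed
  have "e \<in> closed_walk_edges xs \<longleftrightarrow> e \<in> closed_walk_edges ys"
    if "e \<in> cycle_graph n" for e
    using that everywhere by (auto simp: cycle_graph_eq)
  then show ?thesis using cyc K unfolding is_cycle_def by blast
qed

lemma card_Union_doubletons_le:
  assumes "finite K" "\<And>e. e \<in> K \<Longrightarrow> card e \<le> 2"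
  shows "card (\<Union>K) \<le> 2 * card K"
proof -
  have "card (\<Union>K) \<le> sum card K" by (rule card_Union_le_sum_card)
  also have "\<dots> \<le> (\<Sum>e\<in>K. 2)" by (rule sum_mono) (use assms(2) in auto)
  finally show ?thesis by simp
qed

lemma finite_chords: "finite (chords n)"
proof -
  have "chords n \<subseteq> (\<lambda>(u, v). {u, v}) ` ({..<n} \<times> {..<n})" by (auto simp: chords_def)
  then show ?thesis by (rule finite_subset) simp
qed

lemma card_possible_lengths_le:
  assumes n: "3 \<le> n" and k: "1 \<le> k" and P: "P \<subseteq> chords n"
    and all: "has_all_k_chord_cycles n P k"
  shows "card (possible_lengths n k) \<le> (4 * card P) ^ k"
proof -
  have finP: "finite P" using P finite_chords finite_subset by blast
  obtain X where X: "\<And>l. l \<in> possible_lengths n k \<Longrightarrow> length (X l) = l \<and> k_chord_cycle n P k (X l)"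
    using all unfolding has_all_k_chord_cycles_def by metis
  define K where "K l = closed_walk_edges (X l) \<inter> P" for l
  define B where "B l = {v \<in> \<Union>(K l). {v, Suc v mod n} \<in> closed_walk_edges (X l)}" for l
  define S where "S = {Q. Q \<subseteq> P \<and> card Q = k}"
  have inj: "inj_on (\<lambda>l. (K l, B l)) (possible_lengths n k)"
  proof (rule inj_onI)
    fix l l' assume l: "l \<in> possible_lengths n k" "l' \<in> possible_lengths n k"
      and eq: "(K l, B l) = (K l', B l')"
    have cyc: "is_cycle (cycle_graph n \<union> P) (X l)" "is_cycle (cycle_graph n \<union> P) (X l')"
      using X l by (auto simp: k_chord_cycle_def)
    have "K l \<noteq> {}" using X[OF l(1)] k by (auto simp: k_chord_cycle_def K_def)
    then have "closed_walk_edges (X l) = closed_walk_edges (X l')"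
      using edges_determined[OF n P cyc, of "K l"] eq unfolding K_def B_def by auto
    then have "length (X l) = length (X l')"
      using cyc card_closed_walk_edges unfolding is_cycle_def by metis
    then show "l = l'" using X l by simp
  qed
  have sub: "(\<lambda>l. (K l, B l)) ` possible_lengths n k \<subseteq> (SIGMA Q:S. Pow (\<Union>Q))"
    using X by (auto simp: S_def K_def B_def k_chord_cycle_def)
  have finS: "finite S" using finP by (auto simp: S_def)
  have edge: "finite e \<and> card e \<le> 2" if "e \<in> P" for e
    using P that by (fastforce simp: chords_def card_insert_if)
  have Q: "finite (\<Union>Q) \<and> card (Pow (\<Union>Q)) \<le> 4 ^ k" if "Q \<in> S" for Q
  proof -
    have fin: "finite Q" and "Q \<subseteq> P" "card Q = k"
      using that finP finite_subset by (auto simp: S_def)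
    then have "card (\<Union>Q) \<le> 2 * k" using card_Union_doubletons_le[of Q] edge by blast
    then have "(2::nat) ^ card (\<Union>Q) \<le> 2 ^ (2 * k)" by (intro power_increasing) auto
    moreover have "finite (\<Union>Q)" using fin edge \<open>Q \<subseteq> P\<close> by blast
    ultimately show ?thesis by (simp add: card_Pow power_mult)
  qed
  have "card (possible_lengths n k) \<le> card (SIGMA Q:S. Pow (\<Union>Q))"
    by (rule card_inj_on_le[OF inj sub]) (use finS Q in auto)
  also have "\<dots> = (\<Sum>Q\<in>S. card (Pow (\<Union>Q)))"
    using finS Q by (intro card_SigmaI) auto
  also have "\<dots> \<le> (\<Sum>Q\<in>S. 4 ^ k)"
    using Q by (intro sum_mono) auto
  also have "\<dots> = (card P choose k) * 4 ^ k"
    using n_subsets[OF finP] by (simp add: S_def)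
  also have "\<dots> \<le> card P ^ k * 4 ^ k"
    by (cases "k \<le> card P") (auto simp: binomial_le_pow binomial_eq_0)
  finally show ?thesis by (simp add: power_mult_distrib mult.commute)
qed

section \<open>The set of all chords is admissible\<close>

lemma doubleton_in_cycle_graph_iff:
  assumes "u < v" "v < n"
  shows "{u, v} \<in> cycle_graph n \<longleftrightarrow> v = Suc u \<or> u = 0 \<and> v = n - 1"
proof
  assume "{u, v} \<in> cycle_graph n"
  then obtain i where i: "i < n" "{u, v} = {i, Suc i mod n}" unfolding cycle_graph_eq by blast
  show "v = Suc u \<or> u = 0 \<and> v = n - 1"
  proof (cases "Suc i = n")
    case True
    then show ?thesis using i(2) assms by (simp add: doubleton_eq_iff) linarith
  next
    case False
    then have "Suc i mod n = Suc i" using i(1) by simp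
    then show ?thesis using i(2) assms by (simp add: doubleton_eq_iff) linarith
  qed
next
  assume "v = Suc u \<or> u = 0 \<and> v = n - 1"
  then show "{u, v} \<in> cycle_graph n"
  proof
    assume "v = Suc u"
    then have "{u, v} = {u, Suc u mod n}" "u < n" using assms by auto
    then show ?thesis unfolding cycle_graph_eq by blast
  next
    assume "u = 0 \<and> v = n - 1"
    then have "{u, v} = {n - 1, Suc (n - 1) mod n}" "n - 1 < n" using assms by auto
    then show ?thesis unfolding cycle_graph_eq by blast
  qed
qed

lemma k_chord_cycle_map:
  assumes l: "3 \<le> l" and inj: "inj_on f {..<l}" and f: "\<And>i. i < l \<Longrightarrow> f i < n"
    and count: "card {i \<in> {..<l}. {f i, f (Suc i mod l)} \<notin> cycle_graph n} = k"
  shows "k_chord_cycle n (chords n) k (map f [0..<l])"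
proof -
  let ?xs = "map f [0..<l]" and ?e = "\<lambda>i. {f i, f (Suc i mod l)}"
  have less: "Suc i mod l < l" for i using l by simp
  have dist: "distinct ?xs" using inj by (simp add: distinct_map lessThan_atLeast0)
  have nth: "{?xs ! i, ?xs ! (Suc i mod length ?xs)} = ?e i" if "i < l" for i
    using that less by simp
  have edges: "closed_walk_edges ?xs = ?e ` {..<l}"
    unfolding closed_walk_edges_eq_image using nth by (intro image_cong) auto
  have "inj_on (\<lambda>i. {?xs ! i, ?xs ! (Suc i mod length ?xs)}) {..<l}"
    using inj_on_closed_walk_edge[OF dist] l by simp
  then have inj_e: "inj_on ?e {..<l}"
    using nth by (subst (asm) inj_on_cong) auto
  have pair: "?e i \<in> cycle_graph n \<union> chords n" if "i < l" for i
  proof -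
    have "i \<noteq> Suc i mod l" using that l by (auto simp: mod_Suc)
    then have "f i \<noteq> f (Suc i mod l)" using inj that less by (auto dest: inj_onD)
    then show ?thesis using f[OF that] f[OF less] by (auto simp: chords_def)
  qed
  have "closed_walk_edges ?xs \<inter> chords n = ?e ` {i \<in> {..<l}. ?e i \<notin> cycle_graph n}"
    unfolding edges using pair by (auto simp: chords_def)
  also have "card \<dots> = k"
    using card_image[OF inj_on_subset[OF inj_e]] count
    by (metis (no_types, lifting) mem_Collect_eq subsetI)
  finally show ?thesis
    using l dist pair edges unfolding k_chord_cycle_def is_cycle_def by auto
qed

text \<open>
  When at least \<open>k\<close> vertices stay unused, they can serve as gaps: the cycle visits
  \<open>0, 2, \<dots>, 2(k - 1)\<close> and then goes on in steps of one, so that the \<open>k - 1\<close> steps of two and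
  the closing edge are its chords.
\<close>

lemma k_chord_cycle_with_gaps:
  assumes k: "1 \<le> k" "k \<le> l" and l: "3 \<le> l" and n: "k + l \<le> n"
  shows "\<exists>xs. length xs = l \<and> k_chord_cycle n (chords n) k xs"
proof -
  define f where "f i = (if i < k then 2 * i else i + k - 1)" for i
  have mono: "f i < f j" if "i < j" for i j using that k(1) by (auto simp: f_def)
  have bound: "f i \<le> n - 2" if "i < l" for i using that k n by (auto simp: f_def)
  have "{i \<in> {..<l}. {f i, f (Suc i mod l)} \<notin> cycle_graph n} = insert (l - 1) {..<k - 1}"
  proof -
    have closing: "{f (l - 1), f (Suc (l - 1) mod l)} \<notin> cycle_graph n"
    proof -
      have "f (l - 1) = k + l - 2" "f (Suc (l - 1) mod l) = 0"
        using k l by (auto simp: f_def)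
      then show ?thesis
        using doubleton_in_cycle_graph_iff[of 0 "k + l - 2" n] k l n by (auto simp: insert_commute)
    qed
    have inner: "{f i, f (Suc i mod l)} \<notin> cycle_graph n \<longleftrightarrow> i < k - 1" if "i < l - 1" for i
    proof -
      have "Suc i < l" using that by simp
      then have "f (Suc i) < n" "f (Suc i) \<noteq> n - 1" using bound[of "Suc i"] l n by auto
      then show ?thesis
        using doubleton_in_cycle_graph_iff[of "f i" "f (Suc i)" n] mono[of i "Suc i"] that k(1)
        by (auto simp: f_def)
    qed
    have "i < l \<longleftrightarrow> i < l - 1 \<or> i = l - 1" for i using l by auto
    moreover have "i < l - 1" if "i < k - 1" for i using that k by simp
    ultimately show ?thesis using closing inner by auto
  qed
  moreover have "card (insert (l - 1) {..<k - 1}) = k" using k by (simp add: card_insert_if)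
  moreover have "inj_on f {..<l}" using mono by (metis inj_onI linorder_neqE_nat less_irrefl)
  ultimately have "k_chord_cycle n (chords n) k (map f [0..<l])"
    using bound n l by (intro k_chord_cycle_map) (fastforce simp: le_diff_conv)+
  then show ?thesis by (intro exI[of _ "map f [0..<l]"]) simp
qed

text \<open>
  Long cycles leave no room for gaps. Swapping the vertices within each of the first \<open>k - 1\<close>
  pairs, as in \<open>1, 0, 3, 2, 5, 4, 6, 7, \<dots>, l - 1\<close> for \<open>k = 4\<close>, gives one chord after each
  pair, and the closing edge from \<open>l - 1\<close> to \<open>1\<close> is the last chord, even for \<open>l = n\<close>.
\<close>

lemma k_chord_cycle_with_swaps:
  assumes k: "2 \<le> k" "2 * k - 1 \<le> l" and l: "4 \<le> l" "l \<le> n" and n: "6 \<le> n"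
  shows "\<exists>xs. length xs = l \<and> k_chord_cycle n (chords n) k xs"
proof -
  define f where
    "f i = (if i < 2 * k - 2 then if even i then Suc i else i - 1 else i)" for i :: nat
  define odds where "odds = (\<lambda>j. Suc (2 * j)) ` {..<k - 1}"
  have pairs: "f (2 * j) = Suc (2 * j)" "f (Suc (2 * j)) = 2 * j" if "j < k - 1" for j
    using that by (auto simp: f_def)
  have id: "f i = i" if "2 * (k - 1) \<le> i" for i using that by (auto simp: f_def)
  have position: "(\<exists>j<k - 1. i = 2 * j) \<or> (\<exists>j<k - 1. i = Suc (2 * j)) \<or> 2 * (k - 1) \<le> i" for i
    by presburger
  have bound: "f i < l" if "i < l" for i
    using position[of i] that k by (auto simp: pairs id)
  have invol: "f (f i) = i" for i
    using position[of i] by (auto simp: pairs id)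
  have "{i \<in> {..<l}. {f i, f (Suc i mod l)} \<notin> cycle_graph n}
      = insert (l - 1) odds"
  proof -
    have closing: "{f (l - 1), f (Suc (l - 1) mod l)} \<notin> cycle_graph n"
    proof -
      have "f (l - 1) = l - 1" "f (Suc (l - 1) mod l) = 1"
        using k l pairs(1)[of 0] by (auto intro!: id)
      then show ?thesis
        using doubleton_in_cycle_graph_iff[of 1 "l - 1" n] l by (auto simp: insert_commute)
    qed
    have inner: "{f i, f (Suc i)} \<notin> cycle_graph n \<longleftrightarrow> i \<in> odds"
      if i: "i < l - 1" for i
    proof -
      consider j where "j < k - 1" "i = 2 * j" | j where "j < k - 1" "i = Suc (2 * j)"
        | "2 * (k - 1) \<le> i"
        using position[of i] by blast
      then show ?thesis
      proof cases
        case 1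
        have "{2 * j, Suc (2 * j)} \<in> cycle_graph n"
          using doubleton_in_cycle_graph_iff[of "2 * j" "Suc (2 * j)" n] 1 i l by auto
        moreover have "i \<notin> odds" using 1 by (auto simp: odds_def) presburger
        ultimately show ?thesis using 1 by (simp add: pairs insert_commute)
      next
        case 2
        have "f (Suc i) = 2 * j + 2 \<or> f (Suc i) = 2 * j + 3"
          using 2 by (auto simp: f_def)
        moreover have "f (Suc i) < n"
        proof -
          have "Suc i < l" using i by simp
          then show ?thesis using bound[of "Suc i"] l by linarith
        qed
        ultimately have "{2 * j, f (Suc i)} \<notin> cycle_graph n"
          using doubleton_in_cycle_graph_iff[of "2 * j" "f (Suc i)" n] n by auto
        then show ?thesis using 2 by (auto simp: pairs odds_def)
      next
        case 3
        have "{i, Suc i} \<in> cycle_graph n"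
          using doubleton_in_cycle_graph_iff[of i "Suc i" n] i l by auto
        then show ?thesis using 3 by (auto simp: id odds_def)
      qed
    qed
    have in_odds: "i < l - 1" if "i \<in> odds" for i using that k by (auto simp: odds_def)
    have split: "{..<l} = insert (l - 1) {..<l - 1}" using l by auto
    have "{f i, f (Suc i mod l)} \<notin> cycle_graph n \<longleftrightarrow> i \<in> odds" if "i < l - 1" for i
      using inner[OF that] that by simp
    then show ?thesis unfolding split using closing in_odds by blast
  qed
  moreover have "card (insert (l - 1) odds) = k"
  proof -
    have "l - 1 \<notin> odds" "finite odds" using k by (auto simp: odds_def)
    moreover have "card odds = k - 1"
      unfolding odds_def by (subst card_image) (auto simp: inj_on_def)
    ultimately show ?thesis using k by simp
  qed
  moreover have "inj_on f {..<l}" using invol by (metis inj_onI)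
  moreover have "f i < n" if "i < l" for i using bound[OF that] l by simp
  ultimately have "k_chord_cycle n (chords n) k (map f [0..<l])"
    using l by (intro k_chord_cycle_map) auto
  then show ?thesis by (intro exI[of _ "map f [0..<l]"]) simp
qed

lemma all_chords_suffice:
  assumes k: "1 \<le> k" and n: "6 \<le> n" "3 * k \<le> n"
  shows "has_all_k_chord_cycles n (chords n) k"
  unfolding has_all_k_chord_cycles_def
proof
  fix l assume l: "l \<in> possible_lengths n k"
  show "\<exists>xs. length xs = l \<and> k_chord_cycle n (chords n) k xs"
  proof (cases "k + l \<le> n")
    case True
    then show ?thesis
      using k l by (intro k_chord_cycle_with_gaps) (auto simp: possible_lengths_def split: if_splits)
  next
    case False
    then show ?thesis
      using k l n by (intro k_chord_cycle_with_swaps) (auto simp: possible_lengths_def split: if_splits)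
  qed
qed

section \<open>The lower bound\<close>

lemma le_power_min_chords:
  assumes k: "1 \<le> k" and n: "4 * k + 6 \<le> n"
  shows "n \<le> (8 * min_chords n k) ^ k"
proof -
  have "\<exists>m. \<exists>P. P \<subseteq> chords n \<and> card P = m \<and> has_all_k_chord_cycles n P k"
    using all_chords_suffice[of k n] k n by auto
  then have "\<exists>P. P \<subseteq> chords n \<and> card P = min_chords n k \<and> has_all_k_chord_cycles n P k"
    unfolding min_chords_def by (rule LeastI_ex)
  then obtain P where P: "P \<subseteq> chords n" "card P = min_chords n k" "has_all_k_chord_cycles n P k"
    by blast
  have "n \<le> 2 * card (possible_lengths n k)"
    using k n by (auto simp: possible_lengths_def)
  also have "\<dots> \<le> 2 * (4 * card P) ^ k"
    using card_possible_lengths_le[OF _ k P(1,3)] n by simp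
  also have "\<dots> \<le> 2 ^ k * (4 * card P) ^ k"
    using k by (intro mult_right_mono) (auto simp: self_le_power)
  also have "\<dots> = (8 * min_chords n k) ^ k"
    unfolding P(2) power_mult_distrib[symmetric] by simp
  finally show ?thesis .
qed

theorem corollary8:
  fixes k :: nat
  assumes "k \<ge> 1"
  shows "\<exists>C::real. C > 0 \<and> (\<exists>N::nat. \<forall>n::nat. n \<ge> max N (max 6 k) \<longrightarrow>
           real (min_chords n k) \<ge> C * real n powr (1 / real k))"
proof -
  have "1 / 8 * real n powr (1 / real k) \<le> real (min_chords n k)" if "4 * k + 6 \<le> n" for n
  proof -
    let ?m = "8 * min_chords n k"
    have le: "n \<le> ?m ^ k" using le_power_min_chords[OF assms that] .
    have "?m \<noteq> 0"
    proof
      assume "?m = 0"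
      then show False using le that assms by (simp add: power_0_left)
    qed
    then have pos: "0 < real ?m" by linarith
    have "real n \<le> real ?m ^ k" using le by (metis of_nat_le_iff of_nat_power)
    then have "real n \<le> real ?m powr real k" using pos by (simp add: powr_realpow)
    then have "real n powr (1 / real k) \<le> (real ?m powr real k) powr (1 / real k)"
      by (intro powr_mono2) auto
    also have "\<dots> = real ?m" using pos assms by (simp add: powr_powr)
    finally show ?thesis by simp
  qed
  then show ?thesis
    by (intro exI[of _ "1 / 8"] conjI exI[of _ "4 * k + 6"]) auto
qed

end
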